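(* Let $G^\sigma$ be a connected oriented graph of order $n\ge 600$ with $m$ arcs, maximum degree $\Delta$ and skew adjacency matrix $S$, satisfying $$\frac{n}{2}\le\Delta\le\det S\le n^2\quad\text{and}\quad m\le 10n.$$ Then $$2\sqrt{\Delta}+n-2+\ln(\det S)-\ln\Delta\;\geq\;\sqrt{4m+n(n-2)\,(\det S)^{2/n}}.$$
   Context: An oriented graph $G^\sigma$ of a simple graph $G$ on vertices $v_1,\dots,v_n$ is obtained by giving each edge of $G$ one of its two directions; it is connected if $G$ is. Its skew adjacency matrix $S=(s_{ij})$ has $s_{ij}=1$, $s_{ji}=-1$ if $\langle v_i,v_j\rangle$ is an arc, and $s_{ij}=s_{ji}=0$ otherwise. Maximum degree refers to the underlying graph $G$. *)

theory Defs
  imports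
    Complex_Main
    "Graph_Theory.Digraph_Component"
    "Jordan_Normal_Form.Determinant"
begin

text \<open>
  A digraph without loops, parallel arcs or pairs of opposite arcs is the same thing as a simple
  graph with exactly one of the two directions chosen for every edge. The simple graph is recovered
  as \<open>underlying_graph\<close>, where, as usual in the library, an undirected edge is a pair of opposite
  arcs. The library predicate \<open>connected\<close> for digraphs is connectedness of this underlying graph.
\<close>

locale oriented_graph = digraph +
  assumes one_direction: "u \<rightarrow>\<^bsub>G\<^esub> v \<Longrightarrow> \<not> v \<rightarrow>\<^bsub>G\<^esub> u"

abbreviation underlying_graph :: "('a, 'b) pre_digraph \<Rightarrow> ('a, 'a \<times> 'a) pre_digraph" where
  "underlying_graph G \<equiv> with_proj (mk_symmetric G)"

lemma (in digraph) graph_underlying_graph: "graph (underlying_graph G)"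
proof -
  interpret U: pair_digraph "mk_symmetric G" ..
  show ?thesis
    by (rule digraph.graphI) (auto intro: U.digraph_axioms symmetric_mk_symmetric)
qed

lemma (in oriented_graph) underlying_graph_edge_iff:
  "u \<rightarrow>\<^bsub>underlying_graph G\<^esub> v \<longleftrightarrow> (u \<rightarrow>\<^bsub>G\<^esub> v) \<noteq> (v \<rightarrow>\<^bsub>G\<^esub> u)"
  using one_direction[of u v]
  by (auto simp: parcs_mk_symmetric arcs_ends_conv)

text \<open>
  Meant for symmetric digraphs (undirected graphs), where the degree of a vertex is its out-degree,
  which equals its in-degree.
\<close>

definition max_degree :: "('a, 'b) pre_digraph \<Rightarrow> nat" where
  "max_degree H = Max (out_degree H ` verts H)"

text \<open>
  The matrix depends on an enumeration \<open>vs\<close> of the vertices; row and column indices start from 0.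
\<close>

definition skew_adjacency_matrix :: "('a, 'b) pre_digraph \<Rightarrow> 'a list \<Rightarrow> real mat" where
  "skew_adjacency_matrix G vs =
     mat (length vs) (length vs) (\<lambda>(i, j).
       if vs ! i \<rightarrow>\<^bsub>G\<^esub> vs ! j then 1
       else if vs ! j \<rightarrow>\<^bsub>G\<^esub> vs ! i then -1
       else 0)"

end

theory Submission
  imports Defs
begin

text \<open>
  Of the graph only the bounds \<open>\<Delta> \<ge> 300\<close>, \<open>\<Delta> \<le> det S \<le> n\<^sup>2\<close> and \<open>m \<le> 10 n\<close> matter. Put
  \<open>L = ln (det S)\<close>. Squaring both sides and using \<open>exp x \<le> 1 + x + x\<^sup>2\<close> for \<open>x = 2 L / n\<close>, the terms
  \<open>n\<^sup>2\<close> and \<open>2 n L\<close> cancel; after division by \<open>n\<close> it remains to see that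
  \<open>4 sqrt \<Delta> - 2 ln \<Delta>\<close> is at least \<open>42 + 4 L\<^sup>2 / n\<close>. This holds because the left-hand side is at
  least 51 and, since \<open>L \<le> 2 ln n\<close>, the last term is at most 9.
\<close>

text \<open>Using \<open>ln y \<le> y - 1\<close> at \<open>sqrt x / 3\<close> and at 3 gives
  \<open>ln x \<le> 2 / 3 * sqrt x + 2\<close>, and the 2 is at most \<open>sqrt x / 12\<close> once
  \<open>sqrt x \<ge> 24\<close>.\<close>

lemma ln_le_three_quarters_sqrt:
  fixes x :: real
  assumes "x \<ge> 576"
  shows "ln x \<le> 3 / 4 * sqrt x"
proof -
  have s: "sqrt x \<ge> 24" using assms by (intro real_le_rsqrt) simp
  have "ln x = 2 * ln (sqrt x)" using assms by (simp add: ln_sqrt)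
  moreover have "ln (sqrt x) = ln (sqrt x / 3) + ln 3" using assms by (simp add: ln_div)
  moreover have "ln (sqrt x / 3) \<le> sqrt x / 3 - 1" using assms by (intro ln_le_minus_one) simp
  moreover have "ln (3 :: real) \<le> 3 - 1" by (intro ln_le_minus_one) simp
  ultimately show ?thesis using s by linarith
qed

text \<open>The scale 16 is close to \<open>sqrt 300\<close>, so little is lost:
  \<open>2 * ln x \<le> sqrt x / 4 + 12\<close>, which leaves at least 15/4 * 17 - 12 > 51.\<close>

lemma four_sqrt_minus_two_ln_ge:
  fixes x :: real
  assumes "x \<ge> 300"
  shows "4 * sqrt x - 2 * ln x \<ge> 51"
proof -
  have s: "sqrt x \<ge> 17" using assms by (intro real_le_rsqrt) simp
  have "ln (16 :: real) = ln (2 ^ 4)" by simp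
  also have "\<dots> = 4 * ln 2" by (subst ln_realpow) simp_all
  finally have ln16: "ln (16 :: real) \<le> 4" using ln_2_less_1 by linarith
  have "ln (sqrt x) = ln (sqrt x / 16) + ln 16" using assms by (simp add: ln_div)
  moreover have "ln (sqrt x / 16) \<le> sqrt x / 16 - 1" using assms by (intro ln_le_minus_one) simp
  moreover have "ln x = 2 * ln (sqrt x)" using assms by (simp add: ln_sqrt)
  ultimately show ?thesis using s ln16 by linarith
qed

lemma sqrt_le_of_bounds:
  fixes n m \<Delta> d :: real
  assumes n: "n \<ge> 576" and \<Delta>: "\<Delta> \<ge> 300" and d: "\<Delta> \<le> d" "d \<le> n ^ 2" and m: "m \<le> 10 * n"
  shows "sqrt (4 * m + n * (n - 2) * d powr (2 / n)) \<le> 2 * sqrt \<Delta> + n - 2 + ln d - ln \<Delta>"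
proof -
  define L where "L = ln d"
  define x where "x = 2 * L / n"
  \<comment> \<open>The right-hand side of the goal is \<open>n + a\<close>.\<close>
  define a where "a = 2 * sqrt \<Delta> - 2 + L - ln \<Delta>"
  have L0: "L \<ge> 0" using \<Delta> d by (simp add: L_def)
  have "L \<le> ln (n ^ 2)" using \<Delta> d n by (simp add: L_def)
  also have "\<dots> = 2 * ln n" using n by (simp add: ln_realpow)
  also have "\<dots> \<le> 3 / 2 * sqrt n" using ln_le_three_quarters_sqrt[of n] n by simp
  finally have L1: "L \<le> 3 / 2 * sqrt n" .
  have "L ^ 2 \<le> (3 / 2 * sqrt n) ^ 2" using L0 L1 by (intro power_mono)
  then have L2: "4 * L ^ 2 \<le> 9 * n" using n by (simp add: power_mult_distrib power_divide)
  \<comment> \<open>This leads to \<open>x \<le> 1\<close>, the range in which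
    \<open>exp_bound\<close> applies.\<close>
  have "sqrt n * 24 \<le> sqrt n * sqrt n"
    using n by (intro mult_left_mono real_le_rsqrt) simp_all
  then have "24 * sqrt n \<le> n" using n by simp
  then have "2 * L \<le> n" using L1 real_sqrt_ge_zero[of n] n by linarith
  then have x: "0 \<le> x" "x \<le> 1" using L0 n by (simp_all add: x_def)
  have nx: "n * x = 2 * L" using n by (simp add: x_def)
  have "d powr (2 / n) = exp x" using \<Delta> d by (simp add: powr_def x_def L_def)
  also have "\<dots> \<le> 1 + x + x ^ 2" using x by (intro exp_bound)
  finally have "n * (n - 2) * d powr (2 / n) \<le> n * (n - 2) * (1 + x + x ^ 2)"
    using n by (intro mult_left_mono) simp_all
  also have "\<dots> \<le> n * (n - 2) * (1 + x) + n * n * x ^ 2"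
    using n by (simp add: algebra_simps)
  also have "\<dots> = n ^ 2 - 2 * n + n * (n * x) - 2 * (n * x) + (n * x) ^ 2"
    by (simp add: algebra_simps power2_eq_square)
  also have "\<dots> \<le> n ^ 2 - 2 * n + 2 * n * L + 4 * L ^ 2"
    using L0 by (simp add: nx power_mult_distrib)
  \<comment> \<open>47 = 40 - 2 + 9, with 40 from \<open>4 * m\<close> and 9 from
    \<open>4 * L ^ 2\<close>.\<close>
  finally have "4 * m + n * (n - 2) * d powr (2 / n) \<le> n ^ 2 + 47 * n + 2 * n * L"
    using m L2 by linarith
  also have "\<dots> = n ^ 2 + n * (47 + 2 * L)" by (simp add: algebra_simps)
  \<comment> \<open>The bound 51 enters as 51 - 4 = 47, the 4 coming from the -2 in
    \<open>a\<close>.\<close>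
  also have "\<dots> \<le> n ^ 2 + n * (2 * a)"
    using four_sqrt_minus_two_ln_ge[OF \<Delta>] n
    by (intro add_left_mono mult_left_mono) (simp_all add: a_def)
  also have "\<dots> \<le> (n + a) ^ 2" by (simp add: power2_sum)
  finally have sq: "4 * m + n * (n - 2) * d powr (2 / n) \<le> (n + a) ^ 2" .
  have "n + a \<ge> 0"
    using four_sqrt_minus_two_ln_ge[OF \<Delta>] n L0 by (simp add: a_def)
  with sq have "sqrt (4 * m + n * (n - 2) * d powr (2 / n)) \<le> n + a"
    by (intro real_le_lsqrt)
  then show ?thesis by (simp add: a_def L_def)
qed

theorem theorem4p4:
  fixes G :: "('a, 'b) pre_digraph"
    and vs :: "'a list"
    and n m \<Delta> :: nat
    and S :: "real mat"
  assumes "oriented_graph G"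
    and "connected G"
    and "distinct vs" and "set vs = verts G"
    and "n = card (verts G)"
    and "m = card (arcs G)"
    and "\<Delta> = max_degree (underlying_graph G)"
    and "S = skew_adjacency_matrix G vs"
    and "n \<ge> 600"
    and "real n / 2 \<le> real \<Delta>"
    and "real \<Delta> \<le> det S"
    and "det S \<le> real n ^ 2"
    and "m \<le> 10 * n"
  shows "2 * sqrt (real \<Delta>) + real n - 2 + ln (det S) - ln (real \<Delta>)
           \<ge> sqrt (4 * real m + real n * (real n - 2) * (det S) powr (2 / real n))"
  using sqrt_le_of_bounds[of "real n" "real \<Delta>" "det S" "real m"] assms(9-13) by simp

end
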